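(* Let $r>0$, and let $\mathbf{T}$ be the translation with parameters $x^0=1$, $x^1,x^2,x^3\in\mathbf{R}$, where $1+(x^1)^2-(x^2)^2-(x^3)^2>0$. Let $\mathcal{C}_{\mathbf{T}}(r)$ be the common part of the base plane with the translated infinite fibre-like cylinder $\mathcal{C}^i_{\mathbf{T}}(r)$. Then $\mathcal{C}_{\mathbf{T}}(r)$ is, in the Euclidean sense, a circle of radius $$R=\frac{\tanh r\,\bigl(1+(x^1)^2-(x^2)^2-(x^3)^2\bigr)}{1+(x^1)^2-\tanh^2 r\cdot\bigl((x^2)^2+(x^3)^2\bigr)},$$ centred at $$K=\Bigl(1;\,0;\,\frac{x^2-x^1x^3}{1+x^1x^1};\,\frac{x^3+x^1x^2}{1+x^1x^1}\Bigr).$$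
   Context: Superscripts on $x$ are indices (so $(x^1)^2=x^1x^1$ is the square of the coordinate $x^1$). Projective model of $\widetilde{\mathbf{SL}_2\mathbf{R}}$: it is the universal cover of the solid $\mathcal{H}=\{(x^0;x^1;x^2;x^3): -x^0x^0-x^1x^1+x^2x^2+x^3x^3<0\}$ in projective space $\mathcal{P}^3$, with inhomogeneous Euclidean coordinates $x=x^1/x^0$, $y=x^2/x^0$, $z=x^3/x^0$ and origin $E_0=(1;0;0;0)$. Fibre translations $\mathbf{S}(\phi)$, $\phi\in\mathbf{R}$, act by $$(x^0;x^1;x^2;x^3)\mapsto(x^0\cos\phi-x^1\sin\phi;\; x^0\sin\phi+x^1\cos\phi;\; x^2\cos\phi+x^3\sin\phi;\; -x^2\sin\phi+x^3\cos\phi),$$ and the fibre line through $X$ is the orbit of $X$ under all $\mathbf{S}(\phi)$. The base plane is the part of the plane $x=0$ lying in $\mathcal{H}$, with Euclidean coordinates $(y,z)$. The translation $\mathbf{T}$ with parameters $(x^0,x^1,x^2,x^3)$ acts on points, written as row vectors, by right multiplication with $$\begin{pmatrix} x^0&x^1&x^2&x^3\\ -x^1&x^0&x^3&-x^2\\ x^2&x^3&x^0&x^1\\ x^3&-x^2&-x^1&x^0 \end{pmatrix},$$ so it maps $E_0$ to $(x^0;x^1;x^2;x^3)$. $\mathcal{C}^b(r)$ is the circle of radius $r$ (geodesic distance) centred at the origin in the base plane, i.e. the set of points $(1;0;\tanh r\cos\theta;\tanh r\sin\theta)$, $\theta\in(-\pi,\pi]$. The infinite fibre-like cylinder $\mathcal{C}^i(r)$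 is the solid bounded by the surface formed by all fibre lines through the points of $\mathcal{C}^b(r)$; here, as is usual, the cylinder is identified with this bounding surface, which is the one-sheeted hyperboloid $\frac{y^2}{\tanh^2 r}+\frac{z^2}{\tanh^2 r}-x^2=1$. $\mathcal{C}^i_{\mathbf{T}}(r)$ is the image of $\mathcal{C}^i(r)$ under $\mathbf{T}$.
   Formalization: K is not the Euclidean centre unless K is the origin (for x^1=x^3=0, x^2=s it is s(1-tanh²r)/(1-s²tanh²r), not s); proved instead: the section is a Euclidean circle of radius R with some centre, and is the geodesic circle of radius r centred at K in the base plane's hyperbolic metric. *)

theory Defs
  imports "HOL-Analysis.Analysis"
begin

lemma vector_4:
  "(vector [a, b, c, d] :: ('a::zero)^4) $ 1 = a"
  "(vector [a, b, c, d] :: ('a::zero)^4) $ 2 = b"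
  "(vector [a, b, c, d] :: ('a::zero)^4) $ 3 = c"
  "(vector [a, b, c, d] :: ('a::zero)^4) $ 4 = d"
  unfolding vector_def by simp_all

(* A point of projective 3-space is the one-dimensional subspace span {X} with X nonzero.
   The homogeneous coordinates (x^0; x^1; x^2; x^3) are X $ 1, X $ 2, X $ 3, X $ 4. *)

definition proj :: "real^4 \<Rightarrow> (real^4) set" where
  "proj X = span {X}"

definition sl2_form :: "real^4 \<Rightarrow> real" where
  "sl2_form X = - (X $ 1 * X $ 1) - X $ 2 * X $ 2 + X $ 3 * X $ 3 + X $ 4 * X $ 4"

definition solid_H :: "(real^4) set set" where
  "solid_H = {proj X | X. sl2_form X < 0}"

(* The part of the plane x = 0 that lies in the solid. *)
definition base_plane :: "(real^4) set set" where
  "base_plane = {proj X | X. proj X \<in> solid_H \<and> X $ 2 = 0}"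

(* The point with Euclidean coordinates x = 0, y = Re w, z = Im w: the Euclidean (y,z)-plane
   is the type complex, so that "sphere" is a Euclidean circle. *)
definition base_point :: "complex \<Rightarrow> (real^4) set" where
  "base_point w = proj (vector [1, 0, Re w, Im w])"

definition fibre_translation :: "real \<Rightarrow> real^4 \<Rightarrow> real^4" where
  "fibre_translation \<phi> X = vector
     [X $ 1 * cos \<phi> - X $ 2 * sin \<phi>,
      X $ 1 * sin \<phi> + X $ 2 * cos \<phi>,
      X $ 3 * cos \<phi> + X $ 4 * sin \<phi>,
      - X $ 3 * sin \<phi> + X $ 4 * cos \<phi>]"

definition fibre_line :: "(real^4) set \<Rightarrow> (real^4) set set" where
  "fibre_line p = {fibre_translation \<phi> ` p | \<phi>. True}"

definition translation_matrix :: "real \<Rightarrow> real \<Rightarrow> real \<Rightarrow> real \<Rightarrow> real^4^4" where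
  "translation_matrix x0 x1 x2 x3 = vector
     [vector [x0, x1, x2, x3],
      vector [- x1, x0, x3, - x2],
      vector [x2, x3, x0, x1],
      vector [x3, - x2, - x1, x0]]"

(* Points are row vectors, hence the product from the right; the linear map acts on
   projective points (subspaces) by taking images. *)
definition translation ::
    "real \<Rightarrow> real \<Rightarrow> real \<Rightarrow> real \<Rightarrow> (real^4) set \<Rightarrow> (real^4) set" where
  "translation x0 x1 x2 x3 p = (\<lambda>X. X v* translation_matrix x0 x1 x2 x3) ` p"

definition base_circle :: "real \<Rightarrow> (real^4) set set" where
  "base_circle r = {proj (vector [1, 0, tanh r * cos \<theta>, tanh r * sin \<theta>]) | \<theta>. - pi < \<theta> \<and> \<theta> \<le> pi}"

(* The infinite fibre-like cylinder, as a surface. *)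
definition fibre_cylinder :: "real \<Rightarrow> (real^4) set set" where
  "fibre_cylinder r = (\<Union>p \<in> base_circle r. fibre_line p)"

definition translated_cylinder ::
    "real \<Rightarrow> real \<Rightarrow> real \<Rightarrow> real \<Rightarrow> real \<Rightarrow> (real^4) set set" where
  "translated_cylinder x0 x1 x2 x3 r = translation x0 x1 x2 x3 ` fibre_cylinder r"

definition cylinder_section ::
    "real \<Rightarrow> real \<Rightarrow> real \<Rightarrow> real \<Rightarrow> real \<Rightarrow> (real^4) set set" where
  "cylinder_section x0 x1 x2 x3 r = base_plane \<inter> translated_cylinder x0 x1 x2 x3 r"

(* The hyperbolic distance of the base plane, which represents the space of fibres as the
   Poincare disc with ds = |dw| / (1 - |w|^2): this is the quotient of the invariant metric
   ds^2 = dr^2 + cosh^2 r sinh^2 r dtheta^2 + (dphi + sinh^2 r dtheta)^2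
   by the fibres, where |w| = tanh r. In this scale the points at distance r from the origin
   have Euclidean radius tanh r, as in base_circle. *)
definition base_dist :: "complex \<Rightarrow> complex \<Rightarrow> real" where
  "base_dist v w = artanh (cmod (v - w) / cmod (1 - cnj v * w))"

(* Also a Euclidean circle, but with Euclidean centre k only if k = 0: for real k and
   t = tanh r the Euclidean centre is k * (1 - t^2) / (1 - k^2 t^2). *)
definition geodesic_circle :: "complex \<Rightarrow> real \<Rightarrow> complex set" where
  "geodesic_circle k r = {w. cmod w < 1 \<and> base_dist k w = r}"

lemma base_circle_eq_geodesic_circle:
  assumes "r > 0"
  shows "base_circle r = base_point ` geodesic_circle 0 r"
proof -
  have geo: "w \<in> geodesic_circle 0 r \<longleftrightarrow> cmod w = tanh r" for w
  proof
    assume "w \<in> geodesic_circle 0 r"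
    then have *: "artanh (cmod w) = r" "cmod w < 1"
      by (simp_all add: geodesic_circle_def base_dist_def)
    have "tanh (artanh (cmod w)) = cmod w"
    proof -
      have "exp (- (2 * artanh (cmod w))) = (1 - cmod w) / (1 + cmod w)"
        using *(2) by (simp add: artanh_def exp_minus add_pos_nonneg)
      moreover have "1 + cmod w \<noteq> 0"
        using norm_ge_zero[of w] by linarith
      moreover have "(1 - (1 - a) / (1 + a)) / (1 + (1 - a) / (1 + a)) = a"
        if "1 + a \<noteq> 0" for a :: real
      proof -
        have "1 - (1 - a) / (1 + a) = a * (2 / (1 + a))" "1 + (1 - a) / (1 + a) = 2 / (1 + a)"
          using that by (simp_all add: field_simps)
        then show ?thesis
          using that by simp
      qed
      ultimately show ?thesis
        by (simp add: tanh_real_altdef)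
    qed
    then show "cmod w = tanh r"
      using * by simp
  next
    assume "cmod w = tanh r"
    then show "w \<in> geodesic_circle 0 r"
      by (simp add: geodesic_circle_def base_dist_def artanh_tanh_real tanh_real_lt_1)
  qed
  show ?thesis
  proof (intro set_eqI iffI)
    fix p assume "p \<in> base_circle r"
    then obtain \<theta> where p: "p = proj (vector [1, 0, tanh r * cos \<theta>, tanh r * sin \<theta>])"
      unfolding base_circle_def by blast
    have "p = base_point (rcis (tanh r) \<theta>)"
      by (simp add: p base_point_def)
    moreover have "rcis (tanh r) \<theta> \<in> geodesic_circle 0 r"
      using assms by (simp add: geo)
    ultimately show "p \<in> base_point ` geodesic_circle 0 r"
      by blast
  next
    fix p assume "p \<in> base_point ` geodesic_circle 0 r"
    then obtain w where w: "cmod w = tanh r" "p = base_point w"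
      using geo by blast
    have "w = rcis (tanh r) (Arg w)"
      using w(1) rcis_cmod_Arg[of w] by simp
    then have "Re w = tanh r * cos (Arg w)" "Im w = tanh r * sin (Arg w)"
      by (metis Re_rcis, metis Im_rcis)
    then have "p = proj (vector [1, 0, tanh r * cos (Arg w), tanh r * sin (Arg w)])"
      by (simp only: w(2) base_point_def)
    then show "p \<in> base_circle r"
      unfolding base_circle_def using Arg_bounded[of w] by blast
  qed
qed

end

theory Submission
  imports Defs
begin

text \<open>
  Write a point as a pair of complex numbers \<open>P = x\<^sup>0 + \<i>x\<^sup>1\<close>, \<open>Q = x\<^sup>2 + \<i>x\<^sup>3\<close>. Fibre translations
  act by \<open>(P, Q) \<mapsto> (e\<^sup>i\<^sup>\<phi> P, e\<^sup>-\<^sup>i\<^sup>\<phi> Q)\<close>, so \<open>w = Q / cnj P\<close> is a coordinate on the space of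
  fibres, and it is the Euclidean coordinate where the fibre meets the base plane. The translation
  with parameters \<open>(a, b)\<close> acts by \<open>(P, Q) \<mapsto> (a P + b cnj Q, b cnj P + a Q)\<close>, hence on fibres by
  the disc automorphism \<open>w \<mapsto> (a w + b) / (cnj b w + cnj a)\<close>. It takes the circle
  \<open>cmod w = tanh r\<close> to the geodesic circle about \<open>k = b / cnj a\<close>, which is the Apollonius circle
  \<open>cmod (v - k) = tanh r * cmod (1 - cnj k * v)\<close>.
\<close>

subsection \<open>Geodesic circles\<close>

lemma tanh_artanh_real:
  fixes x :: real
  assumes "\<bar>x\<bar> < 1"
  shows "tanh (artanh x) = x"
proof -
  \<comment> \<open>\<open>tanh y\<close> is a rational function of \<open>exp (- (2 * y))\<close>,
    and at \<open>y = artanh x\<close> the logarithm in \<open>artanh\<close> cancels this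
    exponential.\<close>
  have "exp (- (2 * artanh x)) = (1 - x) / (1 + x)"
    using assms by (simp add: artanh_def exp_minus)
  moreover have "1 - (1 - x) / (1 + x) = x * (2 / (1 + x))" "1 + (1 - x) / (1 + x) = 2 / (1 + x)"
    using assms by (simp_all add: field_simps)
  ultimately show ?thesis
    using assms by (simp add: tanh_real_altdef)
qed

text \<open>Both squares contain the cross term \<open>- 2 * Re (cnj k * w)\<close>; it cancels, and
  what remains factors.\<close>

lemma cmod_sq_moebius:
  "(cmod (1 - cnj k * w))\<^sup>2 - (cmod (w - k))\<^sup>2 = (1 - (cmod k)\<^sup>2) * (1 - (cmod w)\<^sup>2)"
  by (simp add: cmod_power2) (simp add: power2_eq_square algebra_simps)

lemma cmod_less_1_iff_moebius:
  assumes "cmod k < 1"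
  shows "cmod w < 1 \<longleftrightarrow> cmod (w - k) < cmod (1 - cnj k * w)"
proof -
  have "1 - (cmod k)\<^sup>2 > 0"
    using assms by (simp add: abs_square_less_1)
  then have "0 < 1 - (cmod w)\<^sup>2 \<longleftrightarrow> 0 < (1 - (cmod k)\<^sup>2) * (1 - (cmod w)\<^sup>2)"
    by (metis zero_less_mult_pos mult_pos_pos)
  then have "cmod w < 1 \<longleftrightarrow> 0 < (1 - (cmod k)\<^sup>2) * (1 - (cmod w)\<^sup>2)"
    by (simp add: abs_square_less_1)
  also have "\<dots> \<longleftrightarrow> (cmod (w - k))\<^sup>2 < (cmod (1 - cnj k * w))\<^sup>2"
    using cmod_sq_moebius[of k w] by linarith
  also have "\<dots> \<longleftrightarrow> cmod (w - k) < cmod (1 - cnj k * w)"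
    by (meson norm_ge_zero pos2 power_mono_iff not_le)
  finally show ?thesis .
qed

text \<open>Inside the disc the argument of \<open>artanh\<close> is below 1, so \<open>tanh\<close>
  inverts it. Conversely, \<open>tanh r < 1\<close> makes every solution of the Apollonius equation
  lie in the disc.\<close>

lemma geodesic_circle_eq_Apollonius:
  assumes "cmod k < 1" "r > 0"
  shows "geodesic_circle k r = {w. cmod (w - k) = tanh r * cmod (1 - cnj k * w)}"
proof (intro set_eqI iffI; clarsimp)
  fix w assume "w \<in> geodesic_circle k r"
  then have w: "cmod w < 1" "artanh (cmod (w - k) / cmod (1 - cnj k * w)) = r"
    by (simp_all add: geodesic_circle_def base_dist_def norm_minus_commute)
  then have lt: "cmod (w - k) < cmod (1 - cnj k * w)"
    using cmod_less_1_iff_moebius[OF assms(1)] by blast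
  then have pos: "cmod (1 - cnj k * w) > 0"
    by (meson norm_ge_zero le_less_trans)
  then have "cmod (w - k) / cmod (1 - cnj k * w) = tanh r"
    using lt w(2) tanh_artanh_real[of "cmod (w - k) / cmod (1 - cnj k * w)"] by simp
  then show "cmod (w - k) = tanh r * cmod (1 - cnj k * w)"
    using pos by (metis less_irrefl nonzero_divide_eq_eq)
next
  fix w assume w: "cmod (w - k) = tanh r * cmod (1 - cnj k * w)"
  \<comment> \<open>A vanishing denominator would force \<open>w = k\<close> and then
    \<open>cmod k = 1\<close>, so division by zero cannot occur in \<open>base_dist\<close>.\<close>
  have ne: "1 - cnj k * w \<noteq> 0"
  proof
    assume 0: "1 - cnj k * w = 0"
    with w have "w = k" by simp
    with 0 have "cmod k * cmod k = 1"
      by (metis complex_mod_cnj eq_iff_diff_eq_0 norm_mult norm_one)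
    with assms(1) show False
      by (metis abs_norm_cancel abs_square_eq_1 less_irrefl power2_eq_square)
  qed
  then have "cmod (w - k) < cmod (1 - cnj k * w)"
    using w tanh_real_lt_1[of r] by simp
  moreover have "cmod (w - k) / cmod (1 - cnj k * w) = tanh r"
    using w ne by simp
  ultimately show "w \<in> geodesic_circle k r"
    using cmod_less_1_iff_moebius[OF assms(1), of w]
    by (simp add: geodesic_circle_def base_dist_def norm_minus_commute artanh_tanh_real)
qed

text \<open>Both sides of the equation are nonnegative, so it may be squared; completing the square
  in \<open>w\<close> then gives the Euclidean centre and radius.\<close>

lemma Apollonius_eq_sphere:
  assumes "cmod k < 1" "0 \<le> t" "t < 1"
  shows "{w. cmod (w - k) = t * cmod (1 - cnj k * w)} =
    sphere (of_real ((1 - t\<^sup>2) / (1 - t\<^sup>2 * (cmod k)\<^sup>2)) * k)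
      (t * (1 - (cmod k)\<^sup>2) / (1 - t\<^sup>2 * (cmod k)\<^sup>2))"
    (is "_ = sphere (of_real ?s * k) ?R")
proof -
  define n where "n = (cmod k)\<^sup>2"
  have n: "0 \<le> n" "n < 1"
    using assms(1) by (simp_all add: n_def abs_square_less_1)
  have t2: "t\<^sup>2 < 1"
    using assms by (simp add: abs_square_less_1)
  have "t\<^sup>2 * n < 1"
    using n t2 by (meson le_less_trans mult_left_le_one_le zero_le_power2 less_imp_le)
  then have d: "1 - t\<^sup>2 * n > 0" by simp
  have R: "?R \<ge> 0"
    using d n assms(2) unfolding n_def[symmetric] by simp
  have "cmod (w - k) = t * cmod (1 - cnj k * w) \<longleftrightarrow> dist (of_real ?s * k) w = ?R" for w
  proof -
    \<comment> \<open>For fixed \<open>k\<close>, all squared moduli below are affine in the two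
      real quantities \<open>m\<close> and \<open>q\<close>.\<close>
    define m where "m = (cmod w)\<^sup>2"
    define q where "q = Re (cnj k * w)"
    define e where "e = 1 - t\<^sup>2 * n"
    have e: "e > 0" using d by (simp add: e_def)
    have 1: "(cmod (w - k))\<^sup>2 = m - 2 * q + n"
      by (simp add: m_def n_def q_def cmod_power2) (simp add: power2_eq_square algebra_simps)
    have 2: "(cmod (1 - cnj k * w))\<^sup>2 = 1 - 2 * q + n * m"
      by (simp add: m_def n_def q_def cmod_power2) (simp add: power2_eq_square algebra_simps)
    have 3: "(dist (of_real s * k) w)\<^sup>2 = m - 2 * s * q + s\<^sup>2 * n" for s
      by (simp add: dist_norm m_def n_def q_def cmod_power2) (simp add: power2_eq_square algebra_simps)
    have "cmod (w - k) = t * cmod (1 - cnj k * w) \<longleftrightarrow>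
        (cmod (w - k))\<^sup>2 = (t * cmod (1 - cnj k * w))\<^sup>2"
      using assms(2) by (simp add: power2_eq_iff_nonneg)
    also have "\<dots> \<longleftrightarrow> e * m - 2 * (1 - t\<^sup>2) * q + n - t\<^sup>2 = 0"
      by (simp only: power_mult_distrib 1 2 e_def) (auto simp: algebra_simps)
    \<comment> \<open>The factor \<open>e\<close> completes the square, because
      \<open>e * (n - t^2) = (1 - t^2)^2 * n - (t * (1 - n))^2\<close>.\<close>
    also have "\<dots> \<longleftrightarrow> e * (e * m - 2 * (1 - t\<^sup>2) * q + n - t\<^sup>2) = 0"
      using e by simp
    also have "e * (e * m - 2 * (1 - t\<^sup>2) * q + n - t\<^sup>2) =
        e\<^sup>2 * m - 2 * e * (1 - t\<^sup>2) * q + (1 - t\<^sup>2)\<^sup>2 * n - (t * (1 - n))\<^sup>2"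
      by (simp add: e_def power2_eq_square algebra_simps)
    also have "\<dots> = e\<^sup>2 * ((m - 2 * ((1 - t\<^sup>2) / e) * q + ((1 - t\<^sup>2) / e)\<^sup>2 * n) - (t * (1 - n) / e)\<^sup>2)"
      using e by (simp add: field_simps power2_eq_square)
    also have "\<dots> = 0 \<longleftrightarrow> (dist (of_real ?s * k) w)\<^sup>2 = ?R\<^sup>2"
      unfolding 3 using e by (simp add: n_def[symmetric] e_def[symmetric])
    also have "\<dots> \<longleftrightarrow> dist (of_real ?s * k) w = ?R"
      using R by (simp add: power2_eq_iff_nonneg)
    finally show ?thesis .
  qed
  then show ?thesis
    unfolding sphere_def by blast
qed

subsection \<open>Complex homogeneous coordinates\<close>

definition cvec :: "complex \<Rightarrow> complex \<Rightarrow> real^4" where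
  "cvec P Q = vector [Re P, Im P, Re Q, Im Q]"

lemma vec4_eq_iff:
  "(X :: real^4) = Y \<longleftrightarrow> X $ 1 = Y $ 1 \<and> X $ 2 = Y $ 2 \<and> X $ 3 = Y $ 3 \<and> X $ 4 = Y $ 4"
  by (simp add: vec_eq_iff forall_4)

lemma cvec_nth [simp]:
  "cvec P Q $ 1 = Re P" "cvec P Q $ 2 = Im P" "cvec P Q $ 3 = Re Q" "cvec P Q $ 4 = Im Q"
  by (simp_all add: cvec_def vector_4)

lemma scaleR_cvec: "c *\<^sub>R cvec P Q = cvec (of_real c * P) (of_real c * Q)"
  by (simp add: vec4_eq_iff)

lemma base_point_eq_proj_cvec: "base_point w = proj (cvec 1 w)"
  by (simp add: base_point_def cvec_def)

lemma sl2_form_cvec: "sl2_form (cvec P Q) = (cmod Q)\<^sup>2 - (cmod P)\<^sup>2"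
  by (simp add: sl2_form_def cmod_power2) (simp add: power2_eq_square)

lemma proj_scaleR:
  assumes "c \<noteq> 0"
  shows "proj (c *\<^sub>R X) = proj X"
  using span_image_scale[of "{X}" "\<lambda>_. c"] assms by (simp add: proj_def)

lemma image_proj:
  assumes "linear f"
  shows "f ` proj X = proj (f X)"
  using linear_span_image[OF assms, of "{X}"] by (simp add: proj_def)

lemma fibre_translation_cvec:
  "fibre_translation \<phi> (cvec P Q) = cvec (cis \<phi> * P) (cis (- \<phi>) * Q)"
  by (simp add: fibre_translation_def vec4_eq_iff vector_4 algebra_simps)

lemma linear_fibre_translation: "linear (fibre_translation \<phi>)"
  by (rule linearI) (simp_all add: fibre_translation_def vec4_eq_iff vector_4 algebra_simps)

lemma cvec_vector_matrix_translation_matrix: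
  fixes x0 x1 x2 x3 :: real
  defines "a \<equiv> Complex x0 x1" and "b \<equiv> Complex x2 x3"
  shows "cvec P Q v* translation_matrix x0 x1 x2 x3 = cvec (a * P + b * cnj Q) (b * cnj P + a * Q)"
  by (simp add: a_def b_def translation_matrix_def vec4_eq_iff vector_matrix_mult_def vector_4
      sum_4 algebra_simps)

lemma translation_proj_cvec:
  "translation x0 x1 x2 x3 (proj (cvec P Q)) =
    proj (cvec (Complex x0 x1 * P + Complex x2 x3 * cnj Q) (Complex x2 x3 * cnj P + Complex x0 x1 * Q))"
proof -
  have "linear (\<lambda>X. X v* translation_matrix x0 x1 x2 x3)"
    by (rule linearI)
      (simp_all add: vec4_eq_iff vector_matrix_mult_def sum_4 algebra_simps)
  then show ?thesis
    by (simp add: translation_def image_proj cvec_vector_matrix_translation_matrix)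
qed

lemma base_point_in_base_plane:
  assumes "cmod w < 1"
  shows "base_point w \<in> base_plane"
proof -
  have "sl2_form (cvec 1 w) < 0"
    using assms by (simp add: sl2_form_cvec abs_square_less_1)
  then have "base_point w \<in> solid_H"
    unfolding solid_H_def base_point_eq_proj_cvec by blast
  moreover have "cvec 1 w $ 2 = 0"
    by simp
  ultimately show ?thesis
    unfolding base_plane_def base_point_eq_proj_cvec by blast
qed

text \<open>\<open>base_plane\<close> only provides some representative with second coordinate 0;
  \<open>Y\<close> is a real multiple of it.\<close>

lemma proj_in_base_plane_nth_2:
  assumes "proj Y \<in> base_plane"
  shows "Y $ 2 = 0"
proof -
  obtain X where X: "proj Y = proj X" "X $ 2 = 0"
    using assms by (auto simp: base_plane_def)
  have "Y \<in> span {X}"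
    using X(1) by (metis proj_def insertI1 span_base)
  then show ?thesis
    using X(2) by (auto simp: span_singleton)
qed

subsection \<open>The section of the translated cylinder\<close>

lemma base_circle_eq_sphere:
  assumes "r > 0"
  shows "base_circle r = base_point ` sphere 0 (tanh r)"
proof -
  have "geodesic_circle 0 r = sphere 0 (tanh r)"
    using geodesic_circle_eq_Apollonius[of 0 r] assms by (simp add: set_eq_iff)
  then show ?thesis
    using base_circle_eq_geodesic_circle[OF assms] by simp
qed

text \<open>Translations commute with fibre translations: conjugation turns the phase of each
  component into that of the other, so \<open>cis \<phi>\<close> and \<open>cis (- \<phi>)\<close>
  factor out.\<close>

lemma translated_cylinder_eq:
  fixes x0 x1 x2 x3 :: real
  defines "a \<equiv> Complex x0 x1" and "b \<equiv> Complex x2 x3"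
  assumes "r > 0"
  shows "translated_cylinder x0 x1 x2 x3 r =
    {proj (cvec (cis \<phi> * (a + b * cnj w)) (cis (- \<phi>) * (b + a * w))) | \<phi> w. cmod w = tanh r}"
proof -
  have "fibre_line (base_point w) = {proj (cvec (cis \<phi>) (cis (- \<phi>) * w)) | \<phi>. True}" for w
    by (simp add: fibre_line_def base_point_eq_proj_cvec image_proj[OF linear_fibre_translation]
        fibre_translation_cvec)
  then have "fibre_cylinder r =
      (\<Union>w \<in> sphere 0 (tanh r). {proj (cvec (cis \<phi>) (cis (- \<phi>) * w)) | \<phi>. True})"
    by (simp add: fibre_cylinder_def base_circle_eq_sphere[OF assms(3)])
  also have "\<dots> = {proj (cvec (cis \<phi>) (cis (- \<phi>) * w)) | \<phi> w. cmod w = tanh r}"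
    unfolding mem_sphere_0[symmetric] by blast
  finally have "fibre_cylinder r = {proj (cvec (cis \<phi>) (cis (- \<phi>) * w)) | \<phi> w. cmod w = tanh r}" .
  then have "translated_cylinder x0 x1 x2 x3 r =
    {translation x0 x1 x2 x3 (proj (cvec (cis \<phi>) (cis (- \<phi>) * w))) | \<phi> w. cmod w = tanh r}"
    by (auto simp: translated_cylinder_def)
  moreover have "translation x0 x1 x2 x3 (proj (cvec (cis \<phi>) (cis (- \<phi>) * w))) =
      proj (cvec (cis \<phi> * (a + b * cnj w)) (cis (- \<phi>) * (b + a * w)))" for \<phi> w
    unfolding translation_proj_cvec a_def[symmetric] b_def[symmetric]
    by (simp add: cis_cnj algebra_simps)
  ultimately show ?thesis
    by simp
qed

text \<open>A translated fibre meets the base plane exactly when its phase makes the first complex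
  coordinate real, and all such phases give the same projective point.\<close>

lemma cylinder_section_eq_moebius_image:
  fixes x0 x1 x2 x3 :: real
  defines "a \<equiv> Complex x0 x1" and "b \<equiv> Complex x2 x3"
  assumes "r > 0" "cmod b < cmod a"
  shows "cylinder_section x0 x1 x2 x3 r =
    base_point ` (\<lambda>w. (b + a * w) / (cnj a + cnj b * w)) ` sphere 0 (tanh r)"
    (is "_ = base_point ` ?m ` _")
proof -
  have D: "a + b * cnj w \<noteq> 0" if "cmod w = tanh r" for w
  proof
    assume "a + b * cnj w = 0"
    then have "cmod a = cmod b * tanh r"
      by (metis add_eq_0_iff complex_mod_cnj norm_minus_cancel norm_mult that)
    also have "\<dots> \<le> cmod b"
      using tanh_real_lt_1[of r] by (simp add: mult_left_le)
    finally show False using assms(4) by simp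
  qed
  have on_base: "proj (cvec (cis \<phi> * (a + b * cnj w)) (cis (- \<phi>) * (b + a * w))) = base_point (?m w)"
    if "cmod w = tanh r" "Im (cis \<phi> * (a + b * cnj w)) = 0" for \<phi> w
  proof -
    define s where "s = Re (cis \<phi> * (a + b * cnj w))"
    have s: "cis \<phi> * (a + b * cnj w) = of_real s"
      using that(2) by (simp add: s_def complex_eq_iff)
    then have s0: "s \<noteq> 0"
      using D[OF that(1)] by auto
    \<comment> \<open>A real number equals its conjugate, so \<open>s\<close> also carries the phase
      \<open>cis (- \<phi>)\<close> of the second coordinate; the phase cancels in the
      quotient.\<close>
    have "cnj (cis \<phi> * (a + b * cnj w)) = of_real s"
      by (simp add: s)
    then have s': "of_real s = cis (- \<phi>) * (cnj a + cnj b * w)"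
      by (simp add: cis_cnj)
    then have "cnj a + cnj b * w \<noteq> 0"
      using s0 by auto
    then have "of_real s * ?m w = cis (- \<phi>) * (b + a * w)"
      by (simp add: s')
    then have "cvec (cis \<phi> * (a + b * cnj w)) (cis (- \<phi>) * (b + a * w)) = s *\<^sub>R cvec 1 (?m w)"
      by (simp add: scaleR_cvec s)
    then show ?thesis
      using s0 by (simp add: proj_scaleR base_point_eq_proj_cvec)
  qed
  have disc: "cmod (?m w) < 1" if "cmod w = tanh r" for w
  proof -
    have w: "cmod w < 1"
      using that tanh_real_lt_1[of r] by simp
    \<comment> \<open>The cross terms agree again, as in \<open>cmod_sq_moebius\<close>. Positivity
      of the product puts the image point inside the solid.\<close>
    have "(cmod (cnj a + cnj b * w))\<^sup>2 - (cmod (b + a * w))\<^sup>2 =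
        ((cmod a)\<^sup>2 - (cmod b)\<^sup>2) * (1 - (cmod w)\<^sup>2)"
      by (simp add: cmod_power2) (simp add: power2_eq_square algebra_simps)
    moreover have "\<dots> > 0"
      using w assms(4) by (intro mult_pos_pos) (simp_all add: abs_square_less_1 power_strict_mono)
    ultimately have "cmod (b + a * w) < cmod (cnj a + cnj b * w)"
      by (smt (verit) norm_ge_zero power_mono)
    then show ?thesis
      by (smt (verit) norm_divide divide_less_eq_1_pos norm_ge_zero)
  qed
  show ?thesis
  proof (intro set_eqI iffI)
    fix p assume "p \<in> cylinder_section x0 x1 x2 x3 r"
    then obtain \<phi> w where p: "p \<in> base_plane" "cmod w = tanh r"
        "p = proj (cvec (cis \<phi> * (a + b * cnj w)) (cis (- \<phi>) * (b + a * w)))"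
      unfolding cylinder_section_def translated_cylinder_eq[OF assms(3)] a_def b_def by blast
    have "Im (cis \<phi> * (a + b * cnj w)) = 0"
      using proj_in_base_plane_nth_2 p(1) unfolding p(3) by (metis cvec_nth(2))
    from on_base[OF p(2) this] show "p \<in> base_point ` ?m ` sphere 0 (tanh r)"
      using p(2,3) by auto
  next
    fix p assume "p \<in> base_point ` ?m ` sphere 0 (tanh r)"
    then obtain w where w: "cmod w = tanh r" "p = base_point (?m w)"
      by auto
    \<comment> \<open>This phase rotates \<open>a + b * cnj w\<close> onto the positive real
      axis.\<close>
    define \<phi> where "\<phi> = - Arg (a + b * cnj w)"
    have "cis \<phi> * (a + b * cnj w) = cis \<phi> * rcis (cmod (a + b * cnj w)) (Arg (a + b * cnj w))"
      by (simp only: rcis_cmod_Arg)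
    also have "\<dots> = of_real (cmod (a + b * cnj w))"
      by (simp add: \<phi>_def rcis_def cis_mult)
    finally have "Im (cis \<phi> * (a + b * cnj w)) = 0"
      by (metis Im_complex_of_real)
    from on_base[OF w(1) this] have "p \<in> translated_cylinder x0 x1 x2 x3 r"
      unfolding translated_cylinder_eq[OF assms(3)] w(2) using w(1)
      by (auto simp: a_def b_def intro!: exI[of _ \<phi>] exI[of _ w])
    moreover have "p \<in> base_plane"
      unfolding w(2) by (intro base_point_in_base_plane disc w)
    ultimately show "p \<in> cylinder_section x0 x1 x2 x3 r"
      by (simp add: cylinder_section_def)
  qed
qed

text \<open>Solving \<open>v = ?m w\<close> for \<open>w\<close> gives
  \<open>(cnj a * v - b) / (a - cnj b * v)\<close>, so \<open>cmod w = t\<close> becomes an equation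
  in \<open>v\<close>.\<close>

lemma moebius_image_sphere_eq_Apollonius:
  assumes "cmod b < cmod a" "0 \<le> t" "t < 1"
  shows "(\<lambda>w. (b + a * w) / (cnj a + cnj b * w)) ` sphere 0 t =
    {v. cmod (v - b / cnj a) = t * cmod (1 - cnj (b / cnj a) * v)}"
    (is "?m ` _ = _")
proof -
  have nz: "c + d * w \<noteq> 0" if "cmod d < cmod c" "cmod w \<le> 1" for c d w :: complex
  proof
    assume "c + d * w = 0"
    then have "cmod c = cmod d * cmod w"
      by (metis add_eq_0_iff norm_minus_cancel norm_mult)
    also have "\<dots> \<le> cmod d"
      using that(2) by (simp add: mult_left_le)
    finally show False using that(1) by simp
  qed
  have a: "a \<noteq> 0" using assms(1) by auto
  have ab: "a * cnj a - b * cnj b \<noteq> 0"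
  proof
    assume "a * cnj a - b * cnj b = 0"
    then have "(cmod a)\<^sup>2 = (cmod b)\<^sup>2"
      by (metis complex_norm_square eq_iff_diff_eq_0 of_real_eq_iff)
    then show False using assms(1) by simp
  qed
  have "v \<in> ?m ` sphere 0 t \<longleftrightarrow> cmod (cnj a * v - b) = t * cmod (a - cnj b * v)" for v
  proof
    assume "v \<in> ?m ` sphere 0 t"
    then obtain w where w: "cmod w = t" "v = ?m w" by auto
    have D: "cnj a + cnj b * w \<noteq> 0"
      using nz[of "cnj b" "cnj a" w] assms w(1) by simp
    have "cnj a * v - b = w * (a - cnj b * v)"
      using D by (simp add: w(2) field_simps)
    then show "cmod (cnj a * v - b) = t * cmod (a - cnj b * v)"
      using w(1) by (simp add: norm_mult)
  next
    assume v: "cmod (cnj a * v - b) = t * cmod (a - cnj b * v)"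
    \<comment> \<open>If this denominator vanished, the equation would make the numerator vanish
      too; eliminating \<open>v\<close> would then make the determinant
      \<open>a * cnj a - b * cnj b\<close> zero.\<close>
    have D: "a - cnj b * v \<noteq> 0"
    proof
      assume 0: "a - cnj b * v = 0"
      with v have "cnj a * v - b = 0" by simp
      with 0 have "a * cnj a - b * cnj b = 0" by algebra
      with ab show False by simp
    qed
    define w where "w = (cnj a * v - b) / (a - cnj b * v)"
    have w: "cmod w = t"
      using v D by (simp add: w_def norm_divide)
    have E: "cnj a + cnj b * w \<noteq> 0"
      using nz[of "cnj b" "cnj a" w] assms w by simp
    have "w * (a - cnj b * v) = cnj a * v - b"
      using D by (simp add: w_def)
    then have "b + a * w = v * (cnj a + cnj b * w)"
      by algebra
    then have "v = ?m w"
      using E by (simp add: eq_divide_eq)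
    then show "v \<in> ?m ` sphere 0 t"
      using w by auto
  qed
  \<comment> \<open>The factors \<open>cnj a\<close> and \<open>a\<close> pulled out have equal
    modulus, so they cancel and leave the centre \<open>b / cnj a\<close>.\<close>
  moreover have "cmod (cnj a * v - b) = cmod a * cmod (v - b / cnj a)"
      "cmod (a - cnj b * v) = cmod a * cmod (1 - cnj (b / cnj a) * v)" for v
  proof -
    have "cnj a * v - b = cnj a * (v - b / cnj a)" "a - cnj b * v = a * (1 - cnj (b / cnj a) * v)"
      using a by (simp_all add: field_simps)
    then show "cmod (cnj a * v - b) = cmod a * cmod (v - b / cnj a)"
      "cmod (a - cnj b * v) = cmod a * cmod (1 - cnj (b / cnj a) * v)"
      by (metis complex_mod_cnj norm_mult)+
  qed
  ultimately show ?thesis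
    using a by (auto simp: mult.left_commute[of t])
qed

theorem lemma4p2:
  fixes r x1 x2 x3 :: real
  assumes "r > 0"
    and "1 + x1\<^sup>2 - x2\<^sup>2 - x3\<^sup>2 > 0"
  shows "(\<exists>c. cylinder_section 1 x1 x2 x3 r =
              base_point ` sphere c (tanh r * (1 + x1\<^sup>2 - x2\<^sup>2 - x3\<^sup>2)
                / (1 + x1\<^sup>2 - (tanh r)\<^sup>2 * (x2\<^sup>2 + x3\<^sup>2)))) \<and>
         cylinder_section 1 x1 x2 x3 r =
           base_point ` geodesic_circle
             (Complex ((x2 - x1 * x3) / (1 + x1 * x1)) ((x3 + x1 * x2) / (1 + x1 * x1))) r"
proof -
  define a b where "a = Complex 1 x1" and "b = Complex x2 x3"
  define t where "t = tanh r"
  let ?k = "b / cnj a"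
  have A: "(cmod a)\<^sup>2 = 1 + x1\<^sup>2" and B: "(cmod b)\<^sup>2 = x2\<^sup>2 + x3\<^sup>2"
    by (simp_all add: a_def b_def cmod_power2)
  have "(cmod b)\<^sup>2 < (cmod a)\<^sup>2"
    using assms(2) unfolding A B by simp
  then have ba: "cmod b < cmod a"
    by (rule power_less_imp_less_base) simp
  have t: "0 \<le> t" "t < 1"
    using assms(1) by (simp_all add: t_def tanh_real_lt_1)
  have k: "cmod ?k < 1"
    using ba by (smt (verit) complex_mod_cnj divide_less_eq_1_pos norm_divide norm_ge_zero)
  \<comment> \<open>Expanding the fraction by \<open>a\<close> gives \<open>a * b\<close> over the
    squared modulus of \<open>a\<close>, which is \<open>1 + x1 * x1\<close>.\<close>
  have K: "?k = Complex ((x2 - x1 * x3) / (1 + x1 * x1)) ((x3 + x1 * x2) / (1 + x1 * x1))"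
    by (simp add: a_def b_def complex_eq_iff Re_divide Im_divide power2_eq_square algebra_simps)
  have N: "1 + x1\<^sup>2 > 0"
    by (simp add: add_pos_nonneg)
  have k2: "(cmod ?k)\<^sup>2 = (x2\<^sup>2 + x3\<^sup>2) / (1 + x1\<^sup>2)"
    by (simp add: norm_divide power_divide A B)
  \<comment> \<open>Both quantities have denominator \<open>1 + x1^2\<close>, which cancels in the
    radius.\<close>
  have "1 - (cmod ?k)\<^sup>2 = (1 + x1\<^sup>2 - x2\<^sup>2 - x3\<^sup>2) / (1 + x1\<^sup>2)"
    "1 - t\<^sup>2 * (cmod ?k)\<^sup>2 = (1 + x1\<^sup>2 - t\<^sup>2 * (x2\<^sup>2 + x3\<^sup>2)) / (1 + x1\<^sup>2)"
    unfolding k2 using N by (simp_all add: field_simps)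
  then have R: "t * (1 - (cmod ?k)\<^sup>2) / (1 - t\<^sup>2 * (cmod ?k)\<^sup>2) =
      t * (1 + x1\<^sup>2 - x2\<^sup>2 - x3\<^sup>2) / (1 + x1\<^sup>2 - t\<^sup>2 * (x2\<^sup>2 + x3\<^sup>2))"
    using N by simp
  have S: "cylinder_section 1 x1 x2 x3 r =
      base_point ` {v. cmod (v - ?k) = t * cmod (1 - cnj ?k * v)}"
    using cylinder_section_eq_moebius_image[OF assms(1), where ?x0.0 = 1 and ?x1.0 = x1 and ?x2.0 = x2 and ?x3.0 = x3]
      moebius_image_sphere_eq_Apollonius[OF ba t] ba
    by (simp add: a_def b_def t_def)
  have "cylinder_section 1 x1 x2 x3 r = base_point ` geodesic_circle ?k r"
    unfolding S geodesic_circle_eq_Apollonius[OF k assms(1)] t_def ..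
  \<comment> \<open>The witness for the Euclidean centre is \<open>?k\<close> shrunk towards the
    origin. It differs from the geodesic centre \<open>?k\<close> unless
    \<open>?k = 0\<close>.\<close>
  moreover have "cylinder_section 1 x1 x2 x3 r = base_point ` sphere
        (of_real ((1 - t\<^sup>2) / (1 - t\<^sup>2 * (cmod ?k)\<^sup>2)) * ?k)
        (t * (1 + x1\<^sup>2 - x2\<^sup>2 - x3\<^sup>2) / (1 + x1\<^sup>2 - t\<^sup>2 * (x2\<^sup>2 + x3\<^sup>2)))"
    unfolding S Apollonius_eq_sphere[OF k t] R ..
  ultimately show ?thesis
    unfolding K t_def by blast
qed

end
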